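(* Let $V$ be a complex vector space of finite dimension $N$ with basis $\{v^i\}_{i=1}^N$ and dual basis $\{v^*_i\}_{i=1}^N$ of $V^*$, and let $\hat R\in\mathrm{Aut}(V^{\otimes 2})$ be a skew invertible R-matrix of BMW type with parameters $q\in\mathbb C\setminus\{0,\pm1\}$, $\nu\in\mathbb C\setminus\{0,q,-q^{-1}\}$. Let $\hat K:=\lambda^{-1}\nu^{-1}(qI-\hat R)(q^{-1}I+\hat R)$, $\lambda:=q-q^{-1}$, and write the matrix of the rank one operator $\hat K$ as $\hat K_{ij}^{kl}=\bar g_{ij}\,g^{kl}$. Let $X,Y\in\mathrm{End}(V)$ be the operators with matrices $$X_i^j:=\sum_k g^{jk}\bar g_{ki},\qquad Y_i^j:=\sum_k \bar g_{ik}\,g^{kj}.$$ Then: (1) The bilinear pairings $g:V\otimes V\to\mathbb C$ and $\bar g:V^*\otimes V^*\to\mathbb C$ given by $$g(x,y):=\sum_{i,j=1}^N x_i\,y_j\,g^{ij},\qquad \bar g(z,t):=\sum_{i,j=1}^N z^i\,t^j\,\bar g_{ij},$$ for $x=\sum_i x_iv^i,\ y=\sum_i y_iv^i\in V$ and $z=\sum_i z^iv^*_i,\ t=\sum_i t^iv^*_i\in V^*$, are nondegenerate. (2) The operators $X$ and $Y$ are inverse to each other. (3) The coefficients $C_k$ of the characteristic polynomial $\det(xI-X)=\sum_{k=0}^N(-1)^kC_k\,x^{N-k}$ satisfy, for some $\epsilon\in\{1,-1\}$ independent of $k$, the reciprocity relations $C_k=\epsilon\,C_{N-k}$ for all $0\le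 k\le N$.
   Context: Notation. For $A\in\mathrm{End}(V^{\otimes 2})$ and $1\le k\ne l\le n$, $A_{kl}\in\mathrm{End}(V^{\otimes n})$ acts as $A$ on the tensor product of the $k$-th and $l$-th factors and as the identity on the other factors; $A_k:=A_{k\,k+1}$. $I$ is the identity operator, $P$ is the permutation $P(u\otimes v)=v\otimes u$, and $\mathrm{Tr}_{(i)}$ is the partial trace over the $i$-th tensor factor. Matrix conventions. Lower indices are row indices and upper indices are column indices: $A\in\mathrm{End}(V)$ has matrix $A_i^j$ with $A(v^j)=\sum_i v^iA_i^j$, so $(AB)_i^j=\sum_kA_i^kB_k^j$; likewise $\hat K(v^k\otimes v^l)=\sum_{i,j}\hat K_{ij}^{kl}\,v^i\otimes v^j$. R-matrix. An element $\hat R\in\mathrm{Aut}(V^{\otimes 2})$ is an R-matrix if $\hat R_1\hat R_2\hat R_1=\hat R_2\hat R_1\hat R_2$ in $\mathrm{End}(V^{\otimes 3})$. Skew invertibility. $\hat R\in\mathrm{Aut}(V^{\otimes 2})$ is skew invertible if there exists $\hat\Psi\in\mathrm{End}(V^{\otimes 2})$ with $\mathrm{Tr}_{(2)}(\hat R_{12}\hat\Psi_{23})=\mathrm{Tr}_{(2)}(\hat\Psi_{12}\hat R_{23})=P_{13}$. Birman-Murakami-Wenzl algebra. For $q\in\mathbb C\setminus\{0,\pm1\}$, $\nu\in\mathbb C\setminus\{0,q,-q^{-1}\}$, $\lambda:=q-q^{-1}$, the algebra $W_n(q,\nu)$ is the quotient of the group algebra of the braid group on $n$ strands, given by generators $e_i$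 (invertible) and $\kappa_i$, $i=1,\dots,n-1$, and relations $$e_ie_{i+1}e_i=e_{i+1}e_ie_{i+1},\qquad e_ie_j=e_je_i\ (|i-j|>1),\qquad e_i^2=1+\lambda(e_i-\nu\kappa_i),$$ $$e_i\kappa_i=\kappa_ie_i=\nu\kappa_i,\qquad \kappa_{i+1}e_i\kappa_{i+1}=\nu^{-1}\kappa_{i+1},\qquad \kappa_{i+1}e_i^{-1}\kappa_{i+1}=\nu\,\kappa_{i+1}.$$ In particular $\kappa_i=\lambda^{-1}\nu^{-1}(q-e_i)(q^{-1}+e_i)$. BMW type. An R-matrix $\hat R$ is of BMW type (with parameters $q,\nu$) if its minimal polynomial has degree $3$ and, for every $n$, the assignment $e_i\mapsto\hat R_i$ (hence $\kappa_i\mapsto\hat K_i$) defines a representation of $W_n(q,\nu)$ on $V^{\otimes n}$. Rank one. For a skew invertible BMW type R-matrix the operator $\hat K$ has rank $1$, so its matrix factorizes as $\hat K_{ij}^{kl}=\bar g_{ij}g^{kl}$; the pair $(\bar g,g)$ is unique up to $(\bar g,g)\mapsto(c\bar g,c^{-1}g)$, $c\in\mathbb C\setminus\{0\}$, and $X,Y$ do not depend on this choice. *)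

theory Defs
  imports
    "HOL-Analysis.Analysis"
    "HOL-Computational_Algebra.Polynomial"
    "HOL-Library.Function_Algebras"
begin

text \<open>
  Throughout, \<open>V\<close> is \<open>complex ^ 'n\<close> with the standard basis \<open>axis i 1\<close>, so \<open>N = CARD('n)\<close>,
  and an operator is identified with its matrix. The lower (row) index is the first index and
  the upper (column) index the second: \<open>A $ i $ j\<close> is \<open>A\<^sub>i\<^sup>j\<close>, and for an operator \<open>A\<close> on
  \<open>V \<otimes> V\<close> the entry \<open>A $ (i, j) $ (k, l)\<close> is the coefficient of \<open>v\<^sup>i \<otimes> v\<^sup>j\<close> in
  \<open>A (v\<^sup>k \<otimes> v\<^sup>l)\<close>.
\<close>

type_synonym 'n op2 = "complex ^ ('n \<times> 'n) ^ ('n \<times> 'n)"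

definition perm_op :: "('n::finite) op2" where
  "perm_op = (\<chi> p r. if fst p = snd r \<and> snd p = fst r then 1 else 0)"


text \<open>
  Tensor powers. The factors carry labels from a finite set \<open>S\<close> of natural numbers
  (\<open>S = {1..n}\<close> for the \<open>n\<close>-th tensor power). The basis vectors of the tensor power are indexed
  by the extensional functions from \<open>S\<close> to the basis index type, and an operator is its matrix
  with respect to this basis. Entries outside \<open>idx S\<close> carry no meaning, so equality of operators
  is \<open>op_eq S\<close>.
\<close>

type_synonym 'n tensor_op = "(nat \<Rightarrow> 'n) \<Rightarrow> (nat \<Rightarrow> 'n) \<Rightarrow> complex"

definition idx :: "nat set \<Rightarrow> (nat \<Rightarrow> 'n) set" where
  "idx S = PiE S (\<lambda>_. UNIV)"

definition op_eq :: "nat set \<Rightarrow> 'n tensor_op \<Rightarrow> 'n tensor_op \<Rightarrow> bool" where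
  "op_eq S A B \<longleftrightarrow> (\<forall>I\<in>idx S. \<forall>J\<in>idx S. A I J = B I J)"

definition op_one :: "'n tensor_op" where
  "op_one = (\<lambda>I J. if I = J then 1 else 0)"

definition op_scale :: "complex \<Rightarrow> 'n tensor_op \<Rightarrow> 'n tensor_op" where
  "op_scale c A = (\<lambda>I J. c * A I J)"

definition op_mult :: "nat set \<Rightarrow> 'n tensor_op \<Rightarrow> 'n tensor_op \<Rightarrow> 'n tensor_op" where
  "op_mult S A B = (\<lambda>I J. \<Sum>K\<in>idx S. A I K * B K J)"

text \<open>The operator \<open>A\<^sub>k\<^sub>l\<close> on the tensor power with label set \<open>S\<close>, for distinct \<open>k\<close>, \<open>l\<close> in \<open>S\<close>.\<close>

definition leg :: "nat set \<Rightarrow> ('n::finite) op2 \<Rightarrow> nat \<Rightarrow> nat \<Rightarrow> 'n tensor_op" where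
  "leg S A k l =
     (\<lambda>I J. if \<forall>m\<in>S - {k, l}. I m = J m then A $ (I k, I l) $ (J k, J l) else 0)"

text \<open>
  The partial trace over factor \<open>i\<close> takes operators with label set \<open>S\<close> to operators with label
  set \<open>S - {i}\<close>; the other factors keep their labels.
\<close>

definition partial_trace :: "nat \<Rightarrow> ('n::finite) tensor_op \<Rightarrow> 'n tensor_op" where
  "partial_trace i A = (\<lambda>I J. \<Sum>a\<in>UNIV. A (I(i := a)) (J(i := a)))"


definition R_matrix :: "('n::finite) op2 \<Rightarrow> bool" where
  "R_matrix R \<longleftrightarrow> invertible R \<and>
     (let S = {1..3}; R1 = leg S R 1 2; R2 = leg S R 2 3 in
        op_eq S (op_mult S (op_mult S R1 R2) R1) (op_mult S (op_mult S R2 R1) R2))"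

definition skew_invertible :: "('n::finite) op2 \<Rightarrow> bool" where
  "skew_invertible R \<longleftrightarrow> invertible R \<and>
     (\<exists>\<Psi> :: 'n op2. let S = {1..3} in
        op_eq {1, 3} (partial_trace 2 (op_mult S (leg S R 1 2) (leg S \<Psi> 2 3)))
                     (leg {1, 3} perm_op 1 3) \<and>
        op_eq {1, 3} (partial_trace 2 (op_mult S (leg S \<Psi> 1 2) (leg S R 2 3)))
                     (leg {1, 3} perm_op 1 3))"


definition poly_matrix :: "complex poly \<Rightarrow> complex ^ 'm ^ 'm \<Rightarrow> complex ^ 'm ^ ('m::finite)" where
  "poly_matrix p A = (\<Sum>i\<le>degree p. mat (coeff p i) ** ((\<lambda>B. A ** B) ^^ i) (mat 1))"

definition is_minimal_poly :: "complex poly \<Rightarrow> complex ^ 'm ^ ('m::finite) \<Rightarrow> bool" where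
  "is_minimal_poly p A \<longleftrightarrow> lead_coeff p = 1 \<and> poly_matrix p A = 0 \<and>
     (\<forall>r. r \<noteq> 0 \<and> poly_matrix r A = 0 \<longrightarrow> degree p \<le> degree r)"


text \<open>
  The assignment of the operators \<open>e i\<close> and \<open>\<kappa> i\<close> (\<open>1 \<le> i \<le> n - 1\<close>) to the generators of the
  Birman-Murakami-Wenzl algebra \<open>W\<^sub>n(q,\<nu>)\<close> defines a representation on the \<open>n\<close>-th tensor power:
  each \<open>e i\<close> is invertible and the defining relations hold.
\<close>

definition bmw_representation ::
  "nat \<Rightarrow> complex \<Rightarrow> complex \<Rightarrow> (nat \<Rightarrow> 'n tensor_op) \<Rightarrow> (nat \<Rightarrow> 'n tensor_op) \<Rightarrow> bool" where
  "bmw_representation n q \<nu> e \<kappa> \<longleftrightarrow>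
     (let S = {1..n}; eq = op_eq S; mul = op_mult S in
      \<exists>e'.
        (\<forall>i\<in>{1..<n}. eq (mul (e i) (e' i)) op_one \<and> eq (mul (e' i) (e i)) op_one) \<and>
        (\<forall>i\<in>{1..<n}. i + 1 < n \<longrightarrow>
           eq (mul (mul (e i) (e (i+1))) (e i)) (mul (mul (e (i+1)) (e i)) (e (i+1)))) \<and>
        (\<forall>i\<in>{1..<n}. \<forall>j\<in>{1..<n}. \<bar>int i - int j\<bar> > 1 \<longrightarrow>
           eq (mul (e i) (e j)) (mul (e j) (e i))) \<and>
        (\<forall>i\<in>{1..<n}.
           eq (mul (e i) (e i)) (op_one + op_scale (q - inverse q) (e i - op_scale \<nu> (\<kappa> i)))) \<and>
        (\<forall>i\<in>{1..<n}. eq (mul (e i) (\<kappa> i)) (op_scale \<nu> (\<kappa> i)) \<and>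
                      eq (mul (\<kappa> i) (e i)) (op_scale \<nu> (\<kappa> i))) \<and>
        (\<forall>i\<in>{1..<n}. i + 1 < n \<longrightarrow>
           eq (mul (mul (\<kappa> (i+1)) (e i)) (\<kappa> (i+1))) (op_scale (inverse \<nu>) (\<kappa> (i+1))) \<and>
           eq (mul (mul (\<kappa> (i+1)) (e' i)) (\<kappa> (i+1))) (op_scale \<nu> (\<kappa> (i+1)))))"

definition K_op :: "complex \<Rightarrow> complex \<Rightarrow> ('n::finite) op2 \<Rightarrow> 'n op2" where
  "K_op q \<nu> R = mat (inverse (q - inverse q) * inverse \<nu>) ** ((mat q - R) ** (mat (inverse q) + R))"

definition bmw_type :: "complex \<Rightarrow> complex \<Rightarrow> ('n::finite) op2 \<Rightarrow> bool" where
  "bmw_type q \<nu> R \<longleftrightarrow> R_matrix R \<and>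
     (\<exists>p. is_minimal_poly p R \<and> degree p = 3) \<and>
     (\<forall>n. bmw_representation n q \<nu>
            (\<lambda>i. leg {1..n} R i (i+1)) (\<lambda>i. leg {1..n} (K_op q \<nu> R) i (i+1)))"


definition dual_space :: "(complex ^ ('n::finite) \<Rightarrow> complex) set" where
  "dual_space = {z. Vector_Spaces.linear (*s) (*) z}"

definition pairing :: "complex ^ 'n ^ 'n \<Rightarrow> complex ^ 'n \<Rightarrow> complex ^ ('n::finite) \<Rightarrow> complex" where
  "pairing g x y = (\<Sum>i\<in>UNIV. \<Sum>j\<in>UNIV. x $ i * y $ j * g $ i $ j)"

text \<open>The coordinate \<open>z\<^sup>i\<close> of \<open>z \<in> V*\<close> in the dual basis is \<open>z (v\<^sup>i)\<close>.\<close>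

definition dual_pairing ::
  "complex ^ 'n ^ 'n \<Rightarrow> (complex ^ 'n \<Rightarrow> complex) \<Rightarrow> (complex ^ ('n::finite) \<Rightarrow> complex) \<Rightarrow> complex" where
  "dual_pairing gb z t = (\<Sum>i\<in>UNIV. \<Sum>j\<in>UNIV. z (axis i 1) * t (axis j 1) * gb $ i $ j)"

definition nondegenerate_on :: "'a::zero set \<Rightarrow> ('a \<Rightarrow> 'a \<Rightarrow> complex) \<Rightarrow> bool" where
  "nondegenerate_on U b \<longleftrightarrow>
     (\<forall>x\<in>U. (\<forall>y\<in>U. b x y = 0) \<longrightarrow> x = 0) \<and> (\<forall>y\<in>U. (\<forall>x\<in>U. b x y = 0) \<longrightarrow> y = 0)"

end

theory Submission
  imports Defs
begin

text \<open>
  The Birman-Murakami-Wenzl relations imply \<open>\<kappa>\<^bsub>i+1\<^esub> \<kappa>\<^bsub>i\<^esub> \<kappa>\<^bsub>i+1\<^esub> = \<kappa>\<^bsub>i+1\<^esub>\<close>. For a rank one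
  operator \<open>K\<close> with matrix \<open>gb\<^sub>i\<^sub>j g\<^sup>k\<^sup>l\<close>, contracting the outer two factors of
  \<open>K\<^sub>2 K\<^sub>1 K\<^sub>2\<close> with the middle one leaves the operator \<open>Y X\<close> on the first tensor factor, so
  \<open>K\<^sub>2 (Y X \<otimes> I \<otimes> I) = K\<^sub>2\<close>; as \<open>K \<noteq> 0\<close> (otherwise \<open>R\<close> would have a quadratic annihilating
  polynomial), \<open>Y X = I\<close>. Since \<open>Y = gb g\<close> and \<open>X = (g gb)\<^sup>T\<close>, both forms are nondegenerate and \<open>X\<close> has
  the same characteristic polynomial as \<open>Y = X\<^sup>-\<^sup>1\<close>, which is therefore self-reciprocal up to the
  sign \<open>det X\<close>.
\<close>

section \<open>Operators on tensor powers\<close>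

lemma finite_idx [simp]: "finite S \<Longrightarrow> finite (idx S :: (nat \<Rightarrow> 'n::finite) set)"
  by (simp add: idx_def finite_PiE)

lemma op_mult_assoc:
  "op_mult S (op_mult S A B) C = op_mult S A (op_mult S B C)"
  unfolding op_mult_def
  by (intro ext, simp only: sum_distrib_left sum_distrib_right mult.assoc) (rule sum.swap)

lemma op_mult_add_left: "op_mult S (A + B) C = op_mult S A C + op_mult S B C"
  by (intro ext) (simp add: op_mult_def algebra_simps sum.distrib)

lemma op_mult_add_right: "op_mult S A (B + C) = op_mult S A B + op_mult S A C"
  by (intro ext) (simp add: op_mult_def algebra_simps sum.distrib)

lemma op_mult_diff_left: "op_mult S (A - B) C = op_mult S A C - op_mult S B C"
  by (intro ext) (simp add: op_mult_def algebra_simps sum_subtractf)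

lemma op_mult_diff_right: "op_mult S A (B - C) = op_mult S A B - op_mult S A C"
  by (intro ext) (simp add: op_mult_def algebra_simps sum_subtractf)

lemma op_mult_scale_left: "op_mult S (op_scale c A) B = op_scale c (op_mult S A B)"
  by (intro ext) (simp add: op_mult_def op_scale_def sum_distrib_left mult.assoc)

lemma op_mult_scale_right: "op_mult S A (op_scale c B) = op_scale c (op_mult S A B)"
  by (intro ext) (simp add: op_mult_def op_scale_def sum_distrib_left mult.left_commute)

lemmas op_mult_linear =
  op_mult_add_left op_mult_add_right op_mult_diff_left op_mult_diff_right
  op_mult_scale_left op_mult_scale_right

text \<open>Products sum over \<open>idx S\<close> alone, so relations known only up to
  \<open>op_eq\<close> may be substituted inside them.\<close>

lemma op_mult_cong:
  assumes "op_eq S A A'" and "op_eq S B B'"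
  shows "op_eq S (op_mult S A B) (op_mult S A' B')"
  using assms unfolding op_eq_def op_mult_def by (auto intro!: sum.cong)

text \<open>Not an equality of functions: in rows outside \<open>idx S\<close> the product
  vanishes.\<close>

lemma op_mult_one_left:
  fixes A :: "('n::finite) tensor_op"
  assumes "finite S"
  shows "op_eq S (op_mult S op_one A) A"
  using assms
  by (simp add: op_eq_def op_mult_def op_one_def if_distrib[of "\<lambda>x. x * _"] sum.delta' cong: if_cong)

lemma op_mult_one_right:
  fixes A :: "('n::finite) tensor_op"
  assumes "finite S"
  shows "op_eq S (op_mult S A op_one) A"
  using assms
  by (simp add: op_eq_def op_mult_def op_one_def if_distrib[of "\<lambda>x. _ * x"] sum.delta cong: if_cong)

lemma op_eq_refl: "op_eq S A A"
  by (simp add: op_eq_def)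

lemma op_eqD: "op_eq S A B \<Longrightarrow> I \<in> idx S \<Longrightarrow> J \<in> idx S \<Longrightarrow> A I J = B I J"
  by (simp add: op_eq_def)

lemma op_scale_apply: "op_scale c A I J = c * A I J"
  by (simp add: op_scale_def)

text \<open>Multiplying the quadratic relation by the inverse \<open>e' i\<close> gives
  \<open>e i = e' i + l (1 - \<kappa> i)\<close>. Between two copies of
  \<open>\<kappa> (i+1)\<close> the two cubic relations evaluate the terms in \<open>e i\<close> and
  \<open>e' i\<close>, and the square of \<open>\<kappa> (i+1)\<close> again follows from the
  quadratic relation.\<close>

lemma bmw_kappa_kappa_kappa:
  fixes e \<kappa> :: "nat \<Rightarrow> ('n::finite) tensor_op"
  assumes rep: "bmw_representation n q \<nu> e \<kappa>"
    and nz: "q - inverse q \<noteq> 0" "\<nu> \<noteq> 0"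
    and i: "1 \<le> i" "i + 1 < n"
  shows "op_eq {1..n} (op_mult {1..n} (op_mult {1..n} (\<kappa> (i+1)) (\<kappa> i)) (\<kappa> (i+1))) (\<kappa> (i+1))"
proof -
  define S where "S = {1..n}"
  define mul :: "'n tensor_op \<Rightarrow> 'n tensor_op \<Rightarrow> 'n tensor_op" where "mul = op_mult S"
  define l where "l = q - inverse q"
  define k where "k = \<kappa> (i+1)"
  have fin: "finite S" by (simp add: S_def)
  have ii: "i \<in> {1..<n}" "i + 1 \<in> {1..<n}" using i by auto
  obtain e' where
    inv: "\<forall>i\<in>{1..<n}. op_eq S (mul (e i) (e' i)) op_one \<and> op_eq S (mul (e' i) (e i)) op_one" and
    sq: "\<forall>i\<in>{1..<n}. op_eq S (mul (e i) (e i)) (op_one + op_scale l (e i - op_scale \<nu> (\<kappa> i)))" and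
    ek: "\<forall>i\<in>{1..<n}. op_eq S (mul (e i) (\<kappa> i)) (op_scale \<nu> (\<kappa> i))" and
    kek: "\<forall>i\<in>{1..<n}. i + 1 < n \<longrightarrow>
           op_eq S (mul (mul (\<kappa> (i+1)) (e i)) (\<kappa> (i+1))) (op_scale (inverse \<nu>) (\<kappa> (i+1))) \<and>
           op_eq S (mul (mul (\<kappa> (i+1)) (e' i)) (\<kappa> (i+1))) (op_scale \<nu> (\<kappa> (i+1)))"
    using rep unfolding bmw_representation_def Let_def S_def mul_def l_def by blast
  note lin = op_mult_linear[where ?'a = 'n and S = S, folded mul_def]
  note assoc = op_mult_assoc[where ?'a = 'n and S = S, folded mul_def]
  note cong = op_mult_cong[where ?'a = 'n and S = S, folded mul_def]
  note one = op_mult_one_left[where ?'n = 'n, OF fin, folded mul_def] op_mult_one_right[where ?'n = 'n, OF fin, folded mul_def]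
  have e'k: "\<nu> * mul (e' i) (\<kappa> i) I J = \<kappa> i I J" if IJ: "I \<in> idx S" "J \<in> idx S" for I J
  proof -
    have "\<nu> * mul (e' i) (\<kappa> i) I J = mul (e' i) (op_scale \<nu> (\<kappa> i)) I J"
      by (simp add: lin op_scale_apply)
    also have "\<dots> = mul (e' i) (mul (e i) (\<kappa> i)) I J"
      using op_eqD[OF cong[OF op_eq_refl ek[rule_format, OF ii(1)]] IJ] by simp
    also have "\<dots> = mul op_one (\<kappa> i) I J"
      unfolding assoc[symmetric] using inv ii IJ by (intro op_eqD[OF cong] op_eq_refl) auto
    also have "\<dots> = \<kappa> i I J" by (rule op_eqD[OF one(1) IJ])
    finally show ?thesis .
  qed
  have e_inv: "op_eq S (e i) (e' i + op_scale l (op_one - \<kappa> i))"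
    unfolding op_eq_def
  proof (intro ballI)
    fix I J :: "nat \<Rightarrow> 'n" assume IJ: "I \<in> idx S" "J \<in> idx S"
    have "e i I J = mul op_one (e i) I J" by (rule op_eqD[OF one(1) IJ, symmetric])
    also have "\<dots> = mul (mul (e' i) (e i)) (e i) I J"
      using inv ii IJ by (intro op_eqD[OF cong, symmetric] op_eq_refl) auto
    also have "\<dots> = mul (e' i) (op_one + op_scale l (e i - op_scale \<nu> (\<kappa> i))) I J"
      unfolding assoc using sq ii IJ by (intro op_eqD[OF cong] op_eq_refl) auto
    also have "\<dots> = mul (e' i) op_one I J
        + l * (mul (e' i) (e i) I J - \<nu> * mul (e' i) (\<kappa> i) I J)"
      by (simp add: lin op_scale_apply)
    also have "\<dots> = (e' i + op_scale l (op_one - \<kappa> i)) I J"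
      using op_eqD[OF one(2) IJ] inv ii IJ e'k[OF IJ] by (simp add: op_eq_def op_scale_apply)
    finally show "e i I J = (e' i + op_scale l (op_one - \<kappa> i)) I J" .
  qed
  show ?thesis
    unfolding op_eq_def S_def[symmetric] mul_def[symmetric] k_def[symmetric]
  proof (intro ballI)
    fix I J :: "nat \<Rightarrow> 'n" assume IJ: "I \<in> idx S" "J \<in> idx S"
    let ?e = "e (i+1)"
    have ek2: "op_eq S (mul ?e k) (op_scale \<nu> k)" using ek ii by (auto simp: k_def)
    \<comment> \<open>Evaluating \<open>?e ?e k\<close> both by \<open>?e k = \<nu> k\<close> and by
      the quadratic relation determines \<open>k k\<close>.\<close>
    have "mul (mul ?e ?e) k I J = \<nu> * \<nu> * k I J"
      using op_eqD[OF cong[OF op_eq_refl ek2, of ?e] IJ] op_eqD[OF ek2 IJ]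
      by (simp add: assoc lin op_scale_apply)
    moreover have "mul (mul ?e ?e) k I J
        = mul (op_one + op_scale l (?e - op_scale \<nu> k)) k I J"
      using sq ii IJ unfolding k_def by (intro op_eqD[OF cong] op_eq_refl) auto
    ultimately have kk: "\<nu> * \<nu> * k I J = k I J + l * (\<nu> * k I J - \<nu> * mul k k I J)"
      using op_eqD[OF one(1) IJ, of k] op_eqD[OF ek2 IJ] by (simp add: lin op_scale_apply)
    have "inverse \<nu> * k I J = mul (mul k (e i)) k I J"
      using kek ii i IJ by (auto simp: k_def op_eq_def op_scale_apply)
    also have "\<dots> = mul (mul k (e' i + op_scale l (op_one - \<kappa> i))) k I J"
      using e_inv IJ by (intro op_eqD[OF cong] cong op_eq_refl) auto
    also have "\<dots> = mul (mul k (e' i)) k I J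
        + l * (mul (mul k op_one) k I J - mul (mul k (\<kappa> i)) k I J)"
      by (simp add: lin op_scale_apply)
    also have "mul (mul k (e' i)) k I J = \<nu> * k I J"
      using kek ii i IJ by (auto simp: k_def op_eq_def op_scale_apply)
    also have "mul (mul k op_one) k I J = mul k k I J"
      using op_eqD[OF cong[OF one(2) op_eq_refl] IJ] .
    finally have "\<nu> * (inverse \<nu> * k I J) =
        \<nu> * (\<nu> * k I J + l * (mul k k I J - mul (mul k (\<kappa> i)) k I J))"
      by simp
    then have "k I J = \<nu> * \<nu> * k I J + l * (\<nu> * mul k k I J) - l * \<nu> * mul (mul k (\<kappa> i)) k I J"
      using nz by (simp add: algebra_simps flip: mult.assoc)
    \<comment> \<open>Substituting \<open>kk\<close> cancels the \<open>k k\<close> terms and leaves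
      a multiple by \<open>l * \<nu>\<close>, which is nonzero.\<close>
    then have "l * \<nu> * mul (mul k (\<kappa> i)) k I J = l * \<nu> * k I J"
      unfolding kk by (simp add: algebra_simps)
    then show "mul (mul k (\<kappa> i)) k I J = k I J"
      using nz by (simp add: l_def)
  qed
qed

section \<open>Rank one operators on the third tensor power\<close>

text \<open>The value \<open>undefined\<close> off the three labels makes the function extensional,
  hence a basis index in \<open>idx {1..3}\<close>.\<close>

definition triple_idx :: "'n \<Rightarrow> 'n \<Rightarrow> 'n \<Rightarrow> nat \<Rightarrow> 'n" where
  "triple_idx a b c = (\<lambda>m. if m = 1 then a else if m = 2 then b else if m = 3 then c else undefined)"

lemma triple_idx_simps [simp]:
  "triple_idx a b c (Suc 0) = a" "triple_idx a b c 2 = b" "triple_idx a b c 3 = c"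
  by (simp_all add: triple_idx_def)

lemma labels_1_3: "{1..3::nat} - {1, 2} = {3}" "{1..3::nat} - {2, 3} = {1}"
  by auto

lemma triple_idx_in_idx [simp]: "triple_idx a b c \<in> idx {1..3}"
  by (auto simp: idx_def triple_idx_def PiE_def extensional_def)

lemma bij_betw_triple_idx:
  "bij_betw (\<lambda>(a, b, c). triple_idx a b c) UNIV (idx {1..3})"
proof (rule bij_betwI')
  fix x y :: "'a \<times> 'a \<times> 'a"
  show "((\<lambda>(a, b, c). triple_idx a b c) x = (\<lambda>(a, b, c). triple_idx a b c) y) = (x = y)"
    by (cases x; cases y) (auto dest: fun_cong[where x = "Suc 0"] fun_cong[where x = 2] fun_cong[where x = 3])
next
  fix y :: "nat \<Rightarrow> 'a" assume "y \<in> idx {1..3}"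
  then have "y = triple_idx (y 1) (y 2) (y 3)"
    by (intro ext) (auto simp: idx_def triple_idx_def PiE_def extensional_def)
  then show "\<exists>x\<in>UNIV. y = (\<lambda>(a, b, c). triple_idx a b c) x"
    by (intro bexI[of _ "(y 1, y 2, y 3)"]) auto
qed (simp add: case_prod_unfold del: One_nat_def)

lemma sum_idx_triple:
  fixes f :: "(nat \<Rightarrow> 'n::finite) \<Rightarrow> complex"
  shows "sum f (idx {1..3}) = (\<Sum>a\<in>UNIV. \<Sum>b\<in>UNIV. \<Sum>c\<in>UNIV. f (triple_idx a b c))"
proof -
  have "sum f (idx {1..3}) = (\<Sum>(a, b, c)\<in>UNIV. f (triple_idx a b c))"
    by (simp add: sum.reindex_bij_betw[OF bij_betw_triple_idx, symmetric] case_prod_unfold del: One_nat_def)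
  then show ?thesis
    by (simp add: sum.cartesian_product UNIV_Times_UNIV[symmetric] case_prod_unfold del: UNIV_Times_UNIV)
qed

lemma leg_triple_12:
  "leg {1..3} A 1 2 (triple_idx a b c) (triple_idx d e f) = (if c = f then A $ (a, b) $ (d, e) else 0)"
  unfolding leg_def labels_1_3 by simp

lemma leg_triple_23:
  "leg {1..3} A 2 3 (triple_idx a b c) (triple_idx d e f) = (if a = d then A $ (b, c) $ (e, f) else 0)"
  unfolding leg_def labels_1_3 by simp

text \<open>The outermost \<open>gb\<close> and \<open>g\<close> factor out. What remains is the sum
  over \<open>r\<close>, \<open>s\<close>, \<open>t\<close> of
  \<open>gb(a,r) g(r,t) g(d,s) gb(s,t)\<close>; both inner products end in \<open>t\<close>, hence
  the transpose.\<close>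

lemma rank_one_contraction:
  fixes K :: "('n::finite) op2" and g gb :: "complex ^ 'n ^ 'n"
  assumes K: "\<And>i j k l. K $ (i, j) $ (k, l) = gb $ i $ j * g $ k $ l"
  shows "op_mult {1..3} (op_mult {1..3} (leg {1..3} K 2 3) (leg {1..3} K 1 2)) (leg {1..3} K 2 3)
      (triple_idx a b c) (triple_idx d e f)
    = gb $ b $ c * ((gb ** g) ** transpose (g ** gb)) $ a $ d * g $ e $ f"
proof -
  \<comment> \<open>These rules pull the Kronecker deltas of \<open>leg\<close> out of products and
    sums so that \<open>sum.delta\<close> can collapse them.\<close>
  have *: "(if P then x else 0) * y = (if P then x * y else 0)"
    "y * (if P then x else 0) = (if P then y * x else 0)"
    "(\<Sum>z\<in>UNIV. if P then h z else 0) = (if P then \<Sum>z\<in>UNIV. h z else 0)"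
    for P and x y :: complex and h :: "'n \<Rightarrow> complex"
    by auto
  \<comment> \<open>The column already starts with \<open>d\<close>, since the last factor is the
    identity on leg 1.\<close>
  have 1: "op_mult {1..3} (leg {1..3} K 2 3) (leg {1..3} K 1 2) (triple_idx a b c) (triple_idx d s t)
     = (\<Sum>r\<in>UNIV. gb $ b $ c * g $ r $ t * (gb $ a $ r * g $ d $ s))" for s t
    unfolding op_mult_def sum_idx_triple leg_triple_12 leg_triple_23
    by (simp add: * K sum.delta sum.delta')
  have "op_mult {1..3} (op_mult {1..3} (leg {1..3} K 2 3) (leg {1..3} K 1 2)) (leg {1..3} K 2 3)
      (triple_idx a b c) (triple_idx d e f)
    = (\<Sum>s\<in>UNIV. \<Sum>t\<in>UNIV. (\<Sum>r\<in>UNIV. gb $ b $ c * g $ r $ t * (gb $ a $ r * g $ d $ s)) * (gb $ s $ t * g $ e $ f))"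
    unfolding op_mult_def[of _ "op_mult _ _ _"] sum_idx_triple leg_triple_23
    by (simp add: * K sum.delta sum.delta' 1 del: One_nat_def)
  also have "\<dots> = gb $ b $ c * ((gb ** g) ** transpose (g ** gb)) $ a $ d * g $ e $ f"
    \<comment> \<open>The swap makes \<open>t\<close> the outer sum, as in the product of
      \<open>gb ** g\<close> with the transpose.\<close>
    by (subst sum.swap) (simp add: matrix_matrix_mult_def transpose_def sum_distrib_left sum_distrib_right mult_ac)
  finally show ?thesis .
qed

section \<open>Nonvanishing of \<open>K\<close>\<close>

lemma matrix_mult_diff_left: "(A - B) ** C = A ** C - B ** (C :: 'a::ring_1 ^ 'n ^ 'm)"
  by (simp add: matrix_matrix_mult_def vec_eq_iff algebra_simps sum_subtractf)

lemma matrix_mult_diff_right: "C ** (A - B) = C ** A - (C :: 'a::ring_1 ^ 'n ^ 'm) ** B"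
  by (simp add: matrix_matrix_mult_def vec_eq_iff algebra_simps sum_subtractf)

lemma mat_nth: "mat c $ i $ j = (if i = j then c else 0)"
  by (simp add: mat_def)

lemma mat_mult_nth [simp]:
  fixes A :: "'a::semiring_1 ^ 'n ^ 'm::finite"
  shows "(mat c ** A) $ i $ j = c * A $ i $ j"
  by (simp add: matrix_matrix_mult_def mat_def if_distrib[of "\<lambda>x. x * _"] sum.delta cong: if_cong)

lemma mult_mat_nth [simp]:
  fixes A :: "'a::semiring_1 ^ 'n::finite ^ 'm"
  shows "(A ** mat c) $ i $ j = A $ i $ j * c"
  by (simp add: matrix_matrix_mult_def mat_def if_distrib[of "\<lambda>x. _ * x"] sum.delta' cong: if_cong)

lemma K_op_nonzero:
  fixes R :: "('n::finite) op2"
  assumes "is_minimal_poly p R" "degree p = 3"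
    and "q \<noteq> 0" "q - inverse q \<noteq> 0" "\<nu> \<noteq> 0"
  shows "K_op q \<nu> R \<noteq> 0"
proof
  assume K0: "K_op q \<nu> R = 0"
  \<comment> \<open>This is \<open>(q - x) (1/q + x)\<close> expanded; the nonzero scalar in front
    of \<open>K_op\<close> does not affect its vanishing.\<close>
  define r where "r = [:1, q - inverse q, -1:]"
  have "(mat q - R) ** (mat (inverse q) + R) = (0 :: 'n op2)"
    using K0 assms by (simp add: K_op_def vec_eq_iff)
  moreover have "poly_matrix r R = (mat q - R) ** (mat (inverse q) + R)"
    using assms
    by (simp add: poly_matrix_def r_def numeral_2_eq_2 matrix_mult_diff_left matrix_add_ldistrib)
       (auto simp: vec_eq_iff mat_nth algebra_simps)
  moreover have "r \<noteq> 0" by (simp add: r_def)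
  ultimately have "degree p \<le> degree r"
    using assms(1) by (auto simp: is_minimal_poly_def)
  then show False using assms(2) by (simp add: r_def)
qed

section \<open>Nondegeneracy and reciprocity\<close>

lemma pairing_alt: "pairing g x y = (\<Sum>i\<in>UNIV. x $ i * (g *v y) $ i)"
  by (simp add: pairing_def matrix_vector_mult_def sum_distrib_left mult_ac)

lemma pairing_transpose: "pairing (transpose g) y x = pairing g x y"
  unfolding pairing_def by (subst sum.swap) (simp add: transpose_def mult_ac)

lemma pairing_eq_0_imp:
  assumes "invertible g" "\<And>x. pairing g x y = 0"
  shows "y = 0"
proof -
  have "(g *v y) $ i = 0" for i
    using assms(2)[of "axis i 1"]
    by (simp add: pairing_alt axis_def if_distrib[of "\<lambda>x. x * _"] cong: if_cong)
  then have "g *v y = 0" by (simp add: vec_eq_iff)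
  with assms(1) show ?thesis
    by (metis invertible_def matrix_vector_mul_assoc matrix_vector_mul_lid matrix_vector_mult_0_right)
qed

text \<open>The left kernel of \<open>g\<close> is the right kernel of its transpose, so one kernel
  computation serves both sides.\<close>

lemma nondegenerate_pairing:
  assumes "invertible g"
  shows "nondegenerate_on UNIV (pairing g)"
  unfolding nondegenerate_on_def
  using pairing_eq_0_imp[OF assms] pairing_eq_0_imp[of "transpose g"] assms
  by (auto simp: pairing_transpose invertible_det_nz)

lemma dual_space_eq_0:
  assumes "z \<in> dual_space" "\<And>i. z (axis i 1) = 0"
  shows "z = 0"
proof
  fix x :: "complex ^ 'a"
  interpret z: Vector_Spaces.linear "(*s)" "(*)" z
    using assms(1) by (simp add: dual_space_def)
  have "z x = z (\<Sum>i\<in>UNIV. x $ i *s axis i 1)" by (simp add: basis_expansion)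
  also have "\<dots> = 0" by (simp add: z.sum z.scale assms(2))
  finally show "z x = 0 x" by simp
qed

lemma coordinate_functional_in_dual_space:
  "(\<lambda>x. \<Sum>i\<in>UNIV. c $ i * x $ i) \<in> dual_space"
  unfolding dual_space_def mem_Collect_eq
  by unfold_locales (auto simp: algebra_simps sum.distrib sum_distrib_left)

text \<open>Coordinates in the dual basis identify \<open>dual_space\<close> with the coordinate
  space and carry \<open>dual_pairing gb\<close> to \<open>pairing gb\<close>.\<close>

lemma nondegenerate_dual_pairing:
  fixes gb :: "complex ^ 'n ^ 'n::finite"
  assumes "invertible gb"
  shows "nondegenerate_on dual_space (dual_pairing gb)"
proof -
  define co :: "(complex ^ 'n \<Rightarrow> complex) \<Rightarrow> complex ^ 'n" where "co = (\<lambda>z. \<chi> i. z (axis i 1))"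
  have dual: "dual_pairing gb z t = pairing gb (co z) (co t)" for z t
    by (simp add: dual_pairing_def pairing_def co_def)
  have surj: "\<exists>z\<in>dual_space. co z = c" for c
    by (rule bexI[OF _ coordinate_functional_in_dual_space[of c]])
       (simp add: co_def vec_eq_iff axis_def if_distrib[of "\<lambda>x. _ * x"] cong: if_cong)
  have inj: "z = 0" if "z \<in> dual_space" "co z = 0" for z
    using that by (auto simp: co_def vec_eq_iff intro: dual_space_eq_0)
  show ?thesis
    using nondegenerate_pairing[OF assms] surj inj
    unfolding nondegenerate_on_def dual by (metis UNIV_I)
qed

section \<open>Characteristic polynomials and their reciprocity\<close>

lemma det_mat_mult:
  fixes A :: "complex ^ 'n ^ 'n::finite"
  shows "det (mat c ** A) = c ^ CARD('n) * det A"
proof -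
  have "det (mat c :: complex ^ 'n ^ 'n) = c ^ CARD('n)"
    by (subst det_diagonal) (simp_all add: mat_def)
  then show ?thesis by (simp add: det_mul)
qed

text \<open>The two matrices are conjugate by \<open>A\<close>.\<close>

lemma det_mat_diff_mult_commute:
  fixes A B :: "complex ^ 'n ^ 'n::finite"
  assumes "invertible A"
  shows "det (mat x - A ** B) = det (mat x - B ** A)"
proof -
  have "mat x ** A = A ** mat x" by (simp add: vec_eq_iff)
  then have "(mat x - A ** B) ** A = A ** (mat x - B ** A)"
    by (simp add: matrix_mult_diff_left matrix_mult_diff_right matrix_mul_assoc)
  then have "det (mat x - A ** B) * det A = det A * det (mat x - B ** A)"
    by (metis det_mul)
  moreover have "det A \<noteq> 0" using assms by (simp add: invertible_det_nz)
  ultimately show ?thesis by simp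
qed

text \<open>A nonzero difference would have infinitely many roots. The point 0 is excluded because
  reciprocity substitutes \<open>1 / x\<close>.\<close>

lemma polynomial_function_coeffs_unique:
  fixes c d :: "nat \<Rightarrow> complex"
  assumes "\<And>x. x \<noteq> 0 \<Longrightarrow> (\<Sum>i\<le>n. c i * x ^ i) = (\<Sum>i\<le>n. d i * x ^ i)" and "k \<le> n"
  shows "c k = d k"
proof (rule ccontr)
  assume "c k \<noteq> d k"
  then have "finite {x. (\<Sum>i\<le>n. (c i - d i) * x ^ i) = 0}"
    using assms(2) by (intro polyfun_rootbound_finite) auto
  moreover have "- {0} \<subseteq> {x. (\<Sum>i\<le>n. (c i - d i) * x ^ i) = 0}"
    using assms(1) by (auto simp: algebra_simps sum_subtractf)
  ultimately have "finite (- {0 :: complex})" by (rule finite_subset[rotated])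
  then show False by (simp add: infinite_UNIV_char_0 Compl_eq_Diff_UNIV)
qed

text \<open>For nonzero \<open>x\<close>, \<open>(x - Y) X = x X - 1 = -x (1/x - X)\<close>. Taking
  determinants relates the characteristic polynomial to its reversal, with factor
  \<open>det X\<close>.\<close>

lemma reciprocal_charpoly:
  fixes X Y :: "complex ^ 'n ^ 'n::finite" and C :: "nat \<Rightarrow> complex"
  assumes XY: "Y ** X = mat 1"
    and det: "det X = det Y"
    and char: "\<And>x. det (mat x - X) = det (mat x - Y)"
    and C: "\<And>x. det (mat x - X) = (\<Sum>k=0..CARD('n). (-1) ^ k * C k * x ^ (CARD('n) - k))"
  shows "\<exists>\<epsilon>\<in>{1, -1}. \<forall>k\<le>CARD('n). C k = \<epsilon> * C (CARD('n) - k)"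
proof -
  let ?N = "CARD('n)"
  \<comment> \<open>The sign sought is \<open>det X\<close>.\<close>
  have "det X * det X = 1" using XY det by (metis det_I det_mul)
  then have eps: "det X \<in> {1, -1}" by (simp add: square_eq_1_iff)
  \<comment> \<open>Reindexed by ascending powers, to compare coefficients.\<close>
  have ev: "det (mat x - X) = (\<Sum>i\<le>?N. (-1) ^ (?N - i) * C (?N - i) * x ^ i)" for x
    unfolding C by (rule sum.reindex_bij_witness[of _ "\<lambda>i. ?N - i" "\<lambda>i. ?N - i"]) auto
  have "(\<Sum>i\<le>?N. (-1) ^ (?N - i) * C (?N - i) * det X * x ^ i) = (\<Sum>i\<le>?N. (-1) ^ (?N - i) * C i * x ^ i)"
    if x: "x \<noteq> 0" for x
  proof -
    have "(\<Sum>i\<le>?N. (-1) ^ (?N - i) * C (?N - i) * det X * x ^ i) = det (mat x - Y) * det X"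
      unfolding char[symmetric] ev by (simp add: sum_distrib_left mult_ac)
    also have "\<dots> = det ((mat x - Y) ** X)" by (simp add: det_mul)
    also have "(mat x - Y) ** X = mat (- x) ** (mat (1 / x) - X)"
      using x unfolding matrix_mult_diff_left XY by (auto simp: vec_eq_iff mat_nth algebra_simps)
    also have "det \<dots> = (- x) ^ ?N * det (mat (1 / x) - X)" by (rule det_mat_mult)
    also have "\<dots> = (\<Sum>i\<le>?N. (-1) ^ (?N - i) * C i * x ^ i)"
      unfolding C atMost_atLeast0 sum_distrib_left
    proof (rule sum.cong[OF refl])
      fix i assume "i \<in> {0..?N}"
      \<comment> \<open>With \<open>j = N - i\<close>, the factor \<open>(1/x)^j\<close> cancels
        \<open>x^j\<close> in \<open>(-x)^(i+j)\<close>, and the two signs \<open>(-1)^i\<close>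
        cancel.\<close>
      then obtain j where N: "?N = i + j" by (metis atLeastAtMost_iff le_Suc_ex)
      have sign: "(-1) ^ i * ((-1) ^ i * z) = z" for z :: complex
        by (metis mult.assoc mult_1 power_one power_mult_distrib square_eq_1_iff)
      show "(- x) ^ ?N * ((-1) ^ i * C i * (1 / x) ^ (?N - i)) = (-1) ^ (?N - i) * C i * x ^ i"
        unfolding N using x
        by (simp add: power_add power_divide power_minus[of x i] power_minus[of x j] mult_ac sign)
    qed
    finally show ?thesis .
  qed
  then have "(-1) ^ (?N - k) * C (?N - k) * det X = (-1) ^ (?N - k) * C k" if "k \<le> ?N" for k
    using that by (rule polynomial_function_coeffs_unique)
  then show ?thesis by (intro bexI[OF _ eps]) (simp add: mult.commute)
qed

theorem proposition2:
  fixes R :: "('n::finite) op2" and q \<nu> :: complex and g gb X Y :: "complex ^ 'n ^ 'n"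
  assumes q: "q \<notin> {0, 1, -1}"
    and nu: "\<nu> \<notin> {0, q, - inverse q}"
    and skew: "skew_invertible R"
    and bmw: "bmw_type q \<nu> R"
    and K: "\<And>i j k l. K_op q \<nu> R $ (i, j) $ (k, l) = gb $ i $ j * g $ k $ l"
    and X: "\<And>i j. X $ i $ j = (\<Sum>k\<in>UNIV. g $ j $ k * gb $ k $ i)"
    and Y: "\<And>i j. Y $ i $ j = (\<Sum>k\<in>UNIV. gb $ i $ k * g $ k $ j)"
  shows "(nondegenerate_on UNIV (pairing g) \<and> nondegenerate_on dual_space (dual_pairing gb)) \<and>
    (X ** Y = mat 1 \<and> Y ** X = mat 1) \<and>
    (\<forall>C :: nat \<Rightarrow> complex.
       (\<forall>x. det (mat x - X) = (\<Sum>k=0..CARD('n). (-1) ^ k * C k * x ^ (CARD('n) - k))) \<longrightarrow>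
       (\<exists>\<epsilon>\<in>{1, -1}. \<forall>k\<le>CARD('n). C k = \<epsilon> * C (CARD('n) - k)))"
proof -
  have nz: "q \<noteq> 0" "q - inverse q \<noteq> 0" "\<nu> \<noteq> 0"
    using q nu by (auto simp: field_simps square_eq_1_iff)
  have X': "X = transpose (g ** gb)" and Y': "Y = gb ** g"
    by (simp_all add: vec_eq_iff X Y transpose_def matrix_matrix_mult_def)
  let ?K = "K_op q \<nu> R"
  have "?K \<noteq> 0" using bmw nz K_op_nonzero unfolding bmw_type_def by blast
  \<comment> \<open>A nonzero entry of \<open>K\<close>, kept fixed as the factor to be cancelled
    below.\<close>
  then obtain b c e f where bcef: "gb $ b $ c * g $ e $ f \<noteq> 0"
    by (auto simp: vec_eq_iff K)
  have "bmw_representation 3 q \<nu> (\<lambda>i. leg {1..3} R i (i+1)) (\<lambda>i. leg {1..3} ?K i (i+1))"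
    using bmw unfolding bmw_type_def by blast
  from bmw_kappa_kappa_kappa[OF this nz(2,3), of 1]
  have KKK: "op_eq {1..3} (op_mult {1..3} (op_mult {1..3} (leg {1..3} ?K 2 3) (leg {1..3} ?K 1 2))
      (leg {1..3} ?K 2 3)) (leg {1..3} ?K 2 3)"
    by (simp add: numeral_2_eq_2 numeral_3_eq_3)
  have YX: "Y ** X = mat 1"
  proof (subst vec_eq_iff, intro allI, subst vec_eq_iff, intro allI)
    fix a d
    \<comment> \<open>Compare entries on three strands with legs 2 and 3 fixed; the right side is
      the identity on leg 1.\<close>
    have "gb $ b $ c * (Y ** X) $ a $ d * g $ e $ f = (if a = d then gb $ b $ c * g $ e $ f else 0)"
      using op_eqD[OF KKK triple_idx_in_idx[of a b c] triple_idx_in_idx[of d e f]]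
      unfolding rank_one_contraction[OF K] leg_triple_23 X' Y' K .
    then show "(Y ** X) $ a $ d = mat 1 $ a $ d"
      using bcef by (auto simp: mat_def split: if_splits)
  qed
  then have XY: "X ** Y = mat 1" by (simp add: matrix_left_right_inverse)
  \<comment> \<open>Determinants of \<open>gb ** g ** X = mat 1\<close>: no factor can
    vanish.\<close>
  have "det gb * det g * det X = 1"
    using YX unfolding Y' by (metis det_I det_mul)
  then have inv: "invertible g" "invertible gb"
    by (auto simp: invertible_det_nz)
  have "det (mat x - X) = det (mat x - Y)" for x
  proof -
    \<comment> \<open>Transposition preserves the determinant, and conjugation by \<open>g\<close>
      turns \<open>g ** gb\<close> into \<open>gb ** g\<close>, which is \<open>Y\<close>.\<close>
    have "mat x - X = transpose (mat x - g ** gb)"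
      by (simp add: X' transpose_def mat_def vec_eq_iff)
    then show ?thesis unfolding Y' using det_mat_diff_mult_commute[OF inv(1)] by simp
  qed
  moreover have "det X = det Y" by (simp add: X' Y' det_mul)
  ultimately show ?thesis
    using XY YX nondegenerate_pairing[OF inv(1)] nondegenerate_dual_pairing[OF inv(2)]
      reciprocal_charpoly[OF YX] by blast
qed

end
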